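(* Suppose the Disturbance assumption and the System assumption stated in the context hold. Let the policy be $\pi=\pi_{\mathrm{op}}$ (defined in the context) with preview length $N$ and $M=N/2$, and let $\sigma(x_1)=0$. Let $N>4\zeta^3$ and $\beta\ge 1/\zeta$ for some $\zeta>1$. Then, for any $T>N$, $$J(\pi_{\mathrm{op}})\le\gamma_{\mathrm{op}}^2\sum_{t=1}^T\|w_t\|_2^2,\qquad\text{where}\quad \gamma_{\mathrm{op}}^2=(2\zeta+\rho(N))\,\overline{\gamma}^2,\quad \rho(N)\le\mathcal{O}(1/N),$$ i.e., $\pi_{\mathrm{op}}$ achieves a disturbance gain $\gamma_{\mathrm{op}}^2$.
   Context: System: $x_{t+1}=Ax_t+Bu_t+w_t$, with state $x_t\in\mathbb{R}^n$, control input $u_t\in\mathbb{R}^m$, arbitrary disturbance $w_t\in\mathbb{R}^n$, and known matrices $A,B$. At each time $t$ the controller incurs a cost $c_t(x_t,u_t)$, where the sequence of cost functions $c_t$ is arbitrary. The state is fully observed. The control task has horizon $T$, $[T]=\{1,\dots,T\}$, and the cumulative cost of a policy $\pi$ is $J(\pi)=\sum_{t=1}^T c_t(x_t,u_t)$, evaluated along the trajectory generated by $\pi$ from the initial state $x_1$. The disturbance gain is the ratio of the cumulative cost to the cumulative disturbance energy $\sum_{t=1}^T\|w_t\|_2^2$. At each time $t$ the algorithm has access to a preview of length $N>0$ of the costs and disturbances, $c_{t:t+N-1}$ and $w_{t:t+N-1}$, in addition to the history of observations until $t$. The notation $a_{s:r}$ means $(a_s,\dots,a_r)$. Preview-optimal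 cost: $$V_t(x_t,w_{t:t+N-1}):=\inf_{\tilde u_{t:t+N-1}}\sum_{j=t}^{t+N-1}c_j(\tilde x_j,\tilde u_j),\qquad \tilde x_{j+1}=A\tilde x_j+B\tilde u_j+w_j,\quad \tilde x_t=x_t.$$ Disturbance assumption: $w_t\in\mathcal W$ for all $t\in[T]$, where $\mathcal W$ is compact with $\|w\|_2\le w_c$ for all $w\in\mathcal W$. System assumption: for all $t\in[T]$, (i) $c_t(\cdot,\cdot)$ is continuous and non-negative; (ii) there exist a continuous non-negative function $\sigma:\mathbb{R}^n\to\mathbb{R}_+$ and $\underline{\alpha}>0$ such that $c_t(x_t,u_t)\ge\underline{\alpha}\,\sigma(x_t)$; (iii) there exist $\overline{\alpha}>0$, $\overline{\gamma}>0$ such that $V_t(x,w_{0:N-1})\le\overline{\alpha}\,\sigma(x)+\overline{\gamma}^2\sum_{k=0}^{N-1}\|w_k\|_2^2$, where $w_{0:N-1}$ denotes the disturbance sequence over the length-$N$ window that starts at time $t$. The constant $\beta$ is $\beta:=\underline{\alpha}/\overline{\alpha}$, with $\beta\le 1$. Policy $\pi_{\mathrm{op}}$ with parameters $N$ and $M<N$: let $t_i=(i-1)(N-M)+1$ for $i=1,2,\dots$, so that the horizon is split into intervals $[t_i,t_{i+1}-1]$ of duration $N-M$. At the beginning $t=t_i$ of each interval, observe the current state $x_t$ and the preview $c_{t:t+N-1},w_{t:t+N-1}$, and solve the optimization problem $$\inf_{\tilde u_{t:t+N-1}}\sum_{j=t}^{t+N-1}c_j(\tilde x_j,\tilde u_j)\quad\text{s.t.}\quad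 \tilde x_{j+1}=A\tilde x_j+B\tilde u_j+w_j,\ \ \tilde x_t=x_t,$$ denoting its output (the optimal control sequence) by $\tilde u_{t:t+N-1}$. Set the control input $u_s=\tilde u_s$ for all $s\in[t_i,t_{i+1}-1]$, and repeat in every new interval.
   Formalization: Costs and disturbances beyond the horizon T, which previews near T would need, are taken to be zero (preview windows are cut off at T); with an arbitrary nonzero disturbance at time T+1 the claimed bound fails. *)

theory Defs
  imports "HOL-Analysis.Analysis" "HOL-Library.Landau_Symbols"
begin

(* Time is a natural number and the horizon is {1..T}. The state space is real^'n, the input
   space real^'m; norm on real^'n is the Euclidean norm. *)

definition dynamics ::
  "real^'n^'n \<Rightarrow> real^'m^'n \<Rightarrow> (nat \<Rightarrow> real^'n) \<Rightarrow> nat \<Rightarrow> nat \<Rightarrow>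
   (nat \<Rightarrow> real^'n) \<Rightarrow> (nat \<Rightarrow> real^'m) \<Rightarrow> bool" where
  "dynamics A B w s r x u \<longleftrightarrow>
     (\<forall>t\<in>{s..r}. x (Suc t) = A *v x t + B *v u t + w t)"

definition cost_on ::
  "(nat \<Rightarrow> real^'n \<Rightarrow> real^'m \<Rightarrow> real) \<Rightarrow> nat \<Rightarrow> nat \<Rightarrow>
   (nat \<Rightarrow> real^'n) \<Rightarrow> (nat \<Rightarrow> real^'m) \<Rightarrow> real" where
  "cost_on c s r x u = (\<Sum>t=s..r. c t (x t) (u t))"

(* The preview-optimal cost V_t(x0, w_{t:t+N-1}). The whole sequence w is passed, but only its
   entries at times t, ..., t+N-1 are used. The infimum is over the planned controls up; the
   planned states xp up to time t+N are determined by them. *)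
definition preview_cost ::
  "real^'n^'n \<Rightarrow> real^'m^'n \<Rightarrow> (nat \<Rightarrow> real^'n \<Rightarrow> real^'m \<Rightarrow> real) \<Rightarrow> nat \<Rightarrow>
   nat \<Rightarrow> real^'n \<Rightarrow> (nat \<Rightarrow> real^'n) \<Rightarrow> real" where
  "preview_cost A B c N t x0 w =
     Inf {cost_on c t (t + N - 1) xp up | xp up. xp t = x0 \<and> dynamics A B w t (t + N - 1) xp up}"

definition optimal_plan ::
  "real^'n^'n \<Rightarrow> real^'m^'n \<Rightarrow> (nat \<Rightarrow> real^'n \<Rightarrow> real^'m \<Rightarrow> real) \<Rightarrow> nat \<Rightarrow>
   nat \<Rightarrow> real^'n \<Rightarrow> (nat \<Rightarrow> real^'n) \<Rightarrow> (nat \<Rightarrow> real^'n) \<Rightarrow> (nat \<Rightarrow> real^'m) \<Rightarrow> bool" where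
  "optimal_plan A B c N t x0 w xp up \<longleftrightarrow>
     xp t = x0 \<and> dynamics A B w t (t + N - 1) xp up \<and>
     cost_on c t (t + N - 1) xp up = preview_cost A B c N t x0 w"

definition disturbance_assumption ::
  "(real^'n) set \<Rightarrow> real \<Rightarrow> nat \<Rightarrow> (nat \<Rightarrow> real^'n) \<Rightarrow> bool" where
  "disturbance_assumption W w_c T w \<longleftrightarrow>
     compact W \<and> (\<forall>v\<in>W. norm v \<le> w_c) \<and> (\<forall>t\<in>{1..T}. w t \<in> W)"

(* The constants and the function \<sigma> do not depend on t. The bound on the preview-optimal cost
   is required only for the windows of the given disturbance sequence w, not for every
   sequence of disturbances in the disturbance set. *)
definition system_assumption ::
  "real^'n^'n \<Rightarrow> real^'m^'n \<Rightarrow> (nat \<Rightarrow> real^'n \<Rightarrow> real^'m \<Rightarrow> real) \<Rightarrow> (nat \<Rightarrow> real^'n) \<Rightarrow>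
   nat \<Rightarrow> nat \<Rightarrow> (real^'n \<Rightarrow> real) \<Rightarrow> real \<Rightarrow> real \<Rightarrow> real \<Rightarrow> bool" where
  "system_assumption A B c w N T \<sigma> \<alpha>_lo \<alpha>_up \<gamma> \<longleftrightarrow>
     continuous_on UNIV \<sigma> \<and> (\<forall>x. 0 \<le> \<sigma> x) \<and> 0 < \<alpha>_lo \<and> 0 < \<alpha>_up \<and> 0 < \<gamma> \<and>
     (\<forall>t\<in>{1..T}.
        continuous_on UNIV (\<lambda>(x, u). c t x u) \<and> (\<forall>x u. 0 \<le> c t x u) \<and>
        (\<forall>x u. \<alpha>_lo * \<sigma> x \<le> c t x u) \<and>
        (\<forall>x. preview_cost A B c N t x w \<le>
               \<alpha>_up * \<sigma> x + \<gamma>\<^sup>2 * (\<Sum>k<N. (norm (w (t + k)))\<^sup>2)))"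

(* Near the end of the horizon the preview window t, ..., t+N-1 sticks out of {1..T}. Costs and
   disturbances exist only for times in {1..T}; as total functions they are extended by zero,
   so that the windows are in effect cut off at T. Some convention on w is needed: a nonzero
   w (T + 1) would influence the controls up to time T without entering the
   disturbance energy over {1..T}. *)
definition zero_past_horizon ::
  "nat \<Rightarrow> (nat \<Rightarrow> real^'n \<Rightarrow> real^'m \<Rightarrow> real) \<Rightarrow> (nat \<Rightarrow> real^'n) \<Rightarrow> bool" where
  "zero_past_horizon T c w \<longleftrightarrow> (\<forall>t>T. (\<forall>x u. c t x u = 0) \<and> w t = 0)"

definition interval_start :: "nat \<Rightarrow> nat \<Rightarrow> nat \<Rightarrow> nat" where
  "interval_start N M i = (i - 1) * (N - M) + 1"

(* (x, u) is a closed-loop trajectory of the policy over the horizon {1..T}. This is a relation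
   because minimisers need not be unique: in every interval the policy may follow any of them. *)
definition policy_op ::
  "real^'n^'n \<Rightarrow> real^'m^'n \<Rightarrow> (nat \<Rightarrow> real^'n \<Rightarrow> real^'m \<Rightarrow> real) \<Rightarrow> (nat \<Rightarrow> real^'n) \<Rightarrow>
   nat \<Rightarrow> nat \<Rightarrow> nat \<Rightarrow> (nat \<Rightarrow> real^'n) \<Rightarrow> (nat \<Rightarrow> real^'m) \<Rightarrow> bool" where
  "policy_op A B c w N M T x u \<longleftrightarrow>
     dynamics A B w 1 T x u \<and>
     (\<forall>i\<ge>1. interval_start N M i \<le> T \<longrightarrow>
        (\<exists>xp up. optimal_plan A B c N (interval_start N M i) (x (interval_start N M i)) w xp up \<and>
           (\<forall>s\<in>{interval_start N M i..interval_start N M (i + 1) - 1}. u s = up s)))"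

end

theory Submission
  imports Defs
begin

text \<open>
  Let \<open>S i\<close> be the cost incurred on the \<open>i\<close>-th interval, \<open>R i\<close> the cost of the discarded second
  half of the plan computed there, \<open>V i = S i + R i\<close> the preview-optimal cost, and
  \<open>\<theta> = \<alpha>_up / \<alpha>_lo \<le> \<zeta>\<close>. The first discarded stage gives \<open>\<alpha>_up * \<sigma> \<le> \<theta> * R i\<close> at the start of
  the next interval, hence \<open>V (i + 1) \<le> \<theta> * R i + \<gamma>\<^sup>2 * (window energy)\<close>, and summation gives
  \<open>J \<le> 2 * \<gamma>\<^sup>2 * E + (\<theta> - 1) * \<Sum> R\<close>. By optimality, the tail of a plan from any time \<open>j\<close> of the
  interval costs at most \<open>\<alpha>_up * \<sigma> (x j)\<close> plus the energy of the window starting at \<open>j\<close>.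
  Averaging over \<open>j\<close> bounds \<open>\<Sum> R\<close> by \<open>\<theta> / M * J + 2 * \<gamma>\<^sup>2 * E\<close>, since in total every disturbance
  lies in \<open>N\<close> windows and \<open>N / M = 2\<close>. So \<open>J \<le> 2 * \<zeta> * \<gamma>\<^sup>2 * E + O(1/N) * J\<close>.
\<close>

section \<open>Trajectories and preview-optimal costs\<close>

lemma atLeastAtMost_window: "0 < N \<Longrightarrow> {t..t + N - 1} = {t..<t + N}" for t N :: nat
  by auto

lemma exists_trajectory: "\<exists>x. x t = x0 \<and> dynamics A B w t r x u"
proof -
  define z where "z = rec_nat x0 (\<lambda>k y. A *v y + B *v u (t + k) + w (t + k))"
  have "dynamics A B w t r (\<lambda>s. z (s - t)) u"
    unfolding dynamics_def by (auto simp: z_def Suc_diff_le)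
  then show ?thesis
    by (intro exI[of _ "\<lambda>s. z (s - t)"]) (simp add: z_def)
qed

text \<open>Nonnegative costs bound the set of plan costs below, without which the real
  \<open>Inf\<close> gives no information.\<close>

lemma preview_cost_le:
  assumes "\<And>s x u. t \<le> s \<Longrightarrow> 0 \<le> c s x u"
    and "xp t = x0" "dynamics A B w t (t + N - 1) xp up"
  shows "preview_cost A B c N t x0 w \<le> cost_on c t (t + N - 1) xp up"
  unfolding preview_cost_def
proof (rule cInf_lower)
  show "bdd_below {cost_on c t (t + N - 1) xp up |xp up.
      xp t = x0 \<and> dynamics A B w t (t + N - 1) xp up}"
    by (rule bdd_belowI[of _ 0]) (auto simp: cost_on_def intro!: sum_nonneg assms(1))
qed (use assms in auto)

lemma preview_cost_greatest:
  assumes "\<And>xp up. xp t = x0 \<Longrightarrow> dynamics A B w t (t + N - 1) xp up \<Longrightarrow>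
    K \<le> cost_on c t (t + N - 1) xp up"
  shows "K \<le> preview_cost A B c N t x0 w"
  unfolding preview_cost_def
proof (rule cInf_greatest)
  show "{cost_on c t (t + N - 1) xp up |xp up.
      xp t = x0 \<and> dynamics A B w t (t + N - 1) xp up} \<noteq> {}"
    using exists_trajectory[of t x0 A B w "t + N - 1"] by blast
qed (use assms in auto)

text \<open>Principle of optimality: a competitor from \<open>j\<close> on, spliced onto the plan
  before \<open>j\<close>, is admissible in the original problem, and the shared prefix
  cancels.\<close>

lemma optimal_plan_tail_le:
  assumes nonneg: "\<And>s x u. t \<le> s \<Longrightarrow> 0 \<le> c s x u"
    and plan: "optimal_plan A B c N t x0 w xp up"
    and j: "t \<le> j" "j < t + N"
  shows "(\<Sum>s=j..<t + N. c s (xp s) (up s)) \<le> preview_cost A B c N j (xp j) w"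
proof (rule preview_cost_greatest)
  fix yp vp
  assume y: "yp j = xp j" and dyn: "dynamics A B w j (j + N - 1) yp vp"
  have N: "0 < N"
    using j by auto
  define zp where "zp s = (if s < j then xp s else yp s)" for s
  define zu where "zu s = (if s < j then up s else vp s)" for s
  have "dynamics A B w t (t + N - 1) zp zu"
    unfolding dynamics_def atLeastAtMost_window[OF N]
  proof
    fix s
    assume s: "s \<in> {t..<t + N}"
    have 1: "xp (Suc s) = A *v xp s + B *v up s + w s"
      using plan s N by (auto simp: optimal_plan_def dynamics_def)
    have 2: "yp (Suc s) = A *v yp s + B *v vp s + w s" if "j \<le> s"
      using dyn s N that j by (auto simp: dynamics_def)
    \<comment> \<open>The seam is the middle case, where \<open>yp j = xp j\<close> joins the two
      trajectories.\<close>
    consider "Suc s < j" | "Suc s = j" | "j \<le> s"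
      by linarith
    then show "zp (Suc s) = A *v zp s + B *v zu s + w s"
      by cases (use 1 2 y in \<open>auto simp: zp_def zu_def\<close>)
  qed
  moreover have "zp t = x0"
    using plan j y by (cases "t = j") (auto simp: zp_def optimal_plan_def)
  ultimately have "preview_cost A B c N t x0 w \<le> cost_on c t (t + N - 1) zp zu"
    using nonneg by (intro preview_cost_le) auto
  also have "\<dots> = (\<Sum>s=t..<j. c s (zp s) (zu s)) + (\<Sum>s=j..<t + N. c s (zp s) (zu s))"
    unfolding cost_on_def atLeastAtMost_window[OF N]
    using j by (intro sum.atLeastLessThan_concat[symmetric]) auto
  also have "(\<Sum>s=t..<j. c s (zp s) (zu s)) = (\<Sum>s=t..<j. c s (xp s) (up s))"
    by (rule sum.cong) (auto simp: zp_def zu_def)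
  also have "(\<Sum>s=j..<t + N. c s (zp s) (zu s)) = (\<Sum>s=j..<t + N. c s (yp s) (vp s))"
    by (rule sum.cong) (auto simp: zp_def zu_def)
  \<comment> \<open>The competitor's window ends \<open>j - t\<close> stages after that of the plan;
    these stages cost at least zero.\<close>
  also have "(\<Sum>s=j..<t + N. c s (yp s) (vp s)) \<le> cost_on c j (j + N - 1) yp vp"
    unfolding cost_on_def atLeastAtMost_window[OF N]
    using j by (intro sum_mono2) (auto intro!: nonneg)
  finally have "preview_cost A B c N t x0 w
      \<le> (\<Sum>s=t..<j. c s (xp s) (up s)) + cost_on c j (j + N - 1) yp vp"
    by simp
  moreover have "preview_cost A B c N t x0 w
      = (\<Sum>s=t..<j. c s (xp s) (up s)) + (\<Sum>s=j..<t + N. c s (xp s) (up s))"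
    using plan j sum.atLeastLessThan_concat[of t j "t + N" "\<lambda>s. c s (xp s) (up s)"]
    unfolding optimal_plan_def cost_on_def atLeastAtMost_window[OF N] by auto
  ultimately show "(\<Sum>s=j..<t + N. c s (xp s) (up s)) \<le> cost_on c j (j + N - 1) yp vp"
    by simp
qed

text \<open>The state at \<open>t\<close> depends only on inputs strictly before \<open>t\<close>,
  so \<open>t\<close> may lie one step past either range.\<close>

lemma dynamics_unique:
  assumes "dynamics A B w s r x u" "dynamics A B w s r' x' u'" "x s = x' s"
    and "\<And>k. s \<le> k \<Longrightarrow> k < t \<Longrightarrow> u k = u' k" "s \<le> t" "t \<le> Suc r" "t \<le> Suc r'"
  shows "x t = x' t"
  using assms(5,4,6,7)
proof (induction rule: dec_induct)
  case base
  then show ?case using assms(3) by simp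
next
  case (step n)
  then show ?case
    using assms(1,2) by (auto simp: dynamics_def)
qed

section \<open>Disturbance energy summed over intervals and windows\<close>

lemma sum_intervals:
  fixes f :: "nat \<Rightarrow> 'a::comm_monoid_add"
  shows "(\<Sum>i<I. \<Sum>t=i * M + 1..<Suc i * M + 1. f t) = (\<Sum>t=1..<I * M + 1. f t)"
proof (induction I)
  case (Suc I)
  have "(\<Sum>t=1..<I * M + 1. f t) + (\<Sum>t=I * M + 1..<Suc I * M + 1. f t)
      = (\<Sum>t=1..<Suc I * M + 1. f t)"
    by (rule sum.atLeastLessThan_concat) auto
  then show ?case
    using Suc by simp
qed simp

lemma sum_from_one_le_horizon:
  fixes e :: "nat \<Rightarrow> real"
  assumes "\<And>t. 0 \<le> e t" "\<And>t. T < t \<Longrightarrow> e t = 0"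
  shows "(\<Sum>t=1..<n. e (t + k)) \<le> (\<Sum>t=1..T. e t)"
proof -
  have "(\<Sum>t=1..<n. e (t + k)) = (\<Sum>t=1 + k..<n + k. e t)"
    by (rule sum.shift_bounds_nat_ivl[symmetric])
  also have "\<dots> = (\<Sum>t\<in>{1 + k..<n + k} \<inter> {..T}. e t)"
    by (rule sum.mono_neutral_right) (auto, meson assms(2) leI)
  also have "\<dots> \<le> (\<Sum>t=1..T. e t)"
    by (rule sum_mono2) (use assms(1) in auto)
  finally show ?thesis .
qed

text \<open>After exchanging the sums, each of the \<open>N\<close> offsets \<open>k\<close>
  contributes at most the total energy.\<close>

lemma sum_window_energy_le:
  fixes e :: "nat \<Rightarrow> real"
  assumes "\<And>t. 0 \<le> e t" "\<And>t. T < t \<Longrightarrow> e t = 0"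
  shows "(\<Sum>j=1..<n. \<Sum>k<N. e (j + k)) \<le> real N * (\<Sum>t=1..T. e t)"
proof -
  have "(\<Sum>j=1..<n. \<Sum>k<N. e (j + k)) = (\<Sum>k<N. \<Sum>j=1..<n. e (j + k))"
    by (rule sum.swap)
  also have "\<dots> \<le> (\<Sum>k<N. \<Sum>t=1..T. e t)"
    by (intro sum_mono sum_from_one_le_horizon assms)
  finally show ?thesis
    by simp
qed

text \<open>Windows of length \<open>2 * M\<close> starting \<open>M\<close> apart cover no time
  more than twice.\<close>

lemma sum_interval_window_energy_le:
  fixes e :: "nat \<Rightarrow> real"
  assumes "\<And>t. 0 \<le> e t" "\<And>t. T < t \<Longrightarrow> e t = 0"
  shows "(\<Sum>i<I. \<Sum>k<2 * M. e (i * M + 1 + k)) \<le> 2 * (\<Sum>t=1..T. e t)"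
proof -
  \<comment> \<open>Each window is an interval followed by its shift by \<open>M\<close>, so both
    halves tile under \<open>sum_intervals\<close>.\<close>
  have "(\<Sum>k<2 * M. e (i * M + 1 + k))
      = (\<Sum>t=i * M + 1..<Suc i * M + 1. e t) + (\<Sum>t=i * M + 1..<Suc i * M + 1. e (t + M))" for i
  proof -
    have "(\<Sum>k<2 * M. e (i * M + 1 + k)) = (\<Sum>t=0 + (i * M + 1)..<2 * M + (i * M + 1). e t)"
      by (subst sum.shift_bounds_nat_ivl) (simp add: lessThan_atLeast0 add_ac)
    also have "\<dots> = (\<Sum>t=i * M + 1..<Suc i * M + 1. e t)
        + (\<Sum>t=Suc i * M + 1..<2 * M + (i * M + 1). e t)"
      unfolding add_0 by (intro sum.atLeastLessThan_concat[symmetric]) auto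
    also have "{Suc i * M + 1..<2 * M + (i * M + 1)} = {i * M + 1 + M..<Suc i * M + 1 + M}"
      by (simp add: mult_2 add_ac)
    finally show ?thesis
      by (simp only: sum.shift_bounds_nat_ivl)
  qed
  then have "(\<Sum>i<I. \<Sum>k<2 * M. e (i * M + 1 + k))
      = (\<Sum>t=1..<I * M + 1. e t) + (\<Sum>t=1..<I * M + 1. e (t + M))"
    by (simp only: sum.distrib sum_intervals)
  also have "\<dots> \<le> (\<Sum>t=1..T. e t) + (\<Sum>t=1..T. e t)"
    using sum_from_one_le_horizon[of e T 0 "I * M + 1"] assms
    by (intro add_mono sum_from_one_le_horizon) auto
  finally show ?thesis
    by simp
qed

section \<open>Bounding the closed-loop cost in terms of itself\<close>

text \<open>\<open>J\<close> stays on both sides: its coefficient on the right is of order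
  \<open>1 / N\<close>, so \<open>theorem1\<close> can solve for it, using
  \<open>0 \<le> J\<close>.\<close>

lemma policy_op_gain:
  fixes A :: "real^'n^'n" and B :: "real^'m^'n"
  assumes sys: "system_assumption A B c w N T \<sigma> \<alpha>_lo \<alpha>_up \<gamma>"
    and past: "zero_past_horizon T c w"
    and ratio: "\<alpha>_lo \<le> \<alpha>_up" "\<alpha>_up \<le> \<zeta> * \<alpha>_lo"
    and N: "N = 2 * M" "0 < M"
    and pol: "policy_op A B c w N M T x u"
    and start: "\<sigma> (x 1) = 0" and T: "0 < T"
  defines "J \<equiv> cost_on c 1 T x u"
    and "G \<equiv> \<gamma>\<^sup>2 * (\<Sum>t=1..T. (norm (w t))\<^sup>2)"
  shows "J \<le> 2 * \<zeta> * G + 2 * \<zeta> * (\<zeta> - 1) / real N * J" and "0 \<le> J"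
proof -
  \<comment> \<open>Intervals are counted from zero; \<open>I\<close> is the last one starting
    within the horizon, so \<open>\<tau> I \<le> T < \<tau> (Suc I)\<close>.\<close>
  define \<tau> where "\<tau> i = i * M + 1" for i
  define e where "e t = (norm (w t))\<^sup>2" for t
  define I where "I = (T - 1) div M"
  define \<theta> where "\<theta> = \<alpha>_up / \<alpha>_lo"
  have pos: "0 < \<alpha>_lo" "0 < \<alpha>_up" and \<sigma>_nonneg: "0 \<le> \<sigma> y" for y
    using sys by (auto simp: system_assumption_def)
  have \<theta>: "1 \<le> \<theta>" "\<theta> \<le> \<zeta>" and \<alpha>_up: "\<alpha>_up = \<theta> * \<alpha>_lo"
    using ratio pos by (auto simp: \<theta>_def field_simps)
  have c_zero: "c t y v = 0" if "T < t" for t y v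
    using past that by (auto simp: zero_past_horizon_def)
  have c_nonneg: "0 \<le> c t y v" if "1 \<le> t" for t y v
    using sys that c_zero[of t y v] by (cases "t \<le> T") (auto simp: system_assumption_def)
  have c_lower: "\<alpha>_up * \<sigma> y \<le> \<theta> * c t y v" if "1 \<le> t" "t \<le> T" for t y v
    using sys that \<theta> by (auto simp: system_assumption_def \<alpha>_up mult.assoc intro!: mult_left_mono)
  have V_upper: "preview_cost A B c N t y w \<le> \<alpha>_up * \<sigma> y + \<gamma>\<^sup>2 * (\<Sum>k<N. e (t + k))"
    if "1 \<le> t" "t \<le> T" for t y
    using sys that by (auto simp: system_assumption_def e_def)
  have e: "\<And>t. 0 \<le> e t" "\<And>t. T < t \<Longrightarrow> e t = 0"
    using past by (auto simp: e_def zero_past_horizon_def)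
  have \<tau>_le: "\<tau> i \<le> T" if "i \<le> I" for i
  proof -
    have "i * M \<le> (T - 1) div M * M"
      using that by (simp add: I_def)
    also have "\<dots> \<le> T - 1"
      by simp
    finally show ?thesis
      using T by (simp add: \<tau>_def)
  qed
  have T_less: "T < \<tau> (Suc I)"
    using N T dividend_less_div_times[of M "T - 1"] by (simp add: \<tau>_def I_def)
  have \<tau>_Suc: "\<tau> (Suc i) = \<tau> i + M" for i
    by (simp add: \<tau>_def)
  have start_eq: "interval_start N M (Suc i) = \<tau> i" for i
    using N by (simp add: interval_start_def \<tau>_def)
  have dyn: "dynamics A B w 1 T x u"
    using pol by (simp add: policy_op_def)
  have "\<exists>xp up. optimal_plan A B c N (\<tau> i) (x (\<tau> i)) w xp up \<and>
      (\<forall>s\<in>{\<tau> i..<\<tau> (Suc i)}. u s = up s)" if "i \<le> I" for i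
  proof -
    have "{\<tau> i..\<tau> (Suc i) - 1} = {\<tau> i..<\<tau> (Suc i)}"
      using N by (auto simp: \<tau>_def)
    then show ?thesis
      using pol \<tau>_le[OF that] start_eq[of i] start_eq[of "Suc i"] unfolding policy_op_def
      by (metis Suc_eq_plus1 le_add2)
  qed
  then obtain xp up where plan: "\<And>i. i \<le> I \<Longrightarrow> optimal_plan A B c N (\<tau> i) (x (\<tau> i)) w (xp i) (up i)"
    and u: "\<And>i s. i \<le> I \<Longrightarrow> s \<in> {\<tau> i..<\<tau> (Suc i)} \<Longrightarrow> u s = up i s"
    by metis
  \<comment> \<open>The right endpoint is included: the old plan still fixes the state there, and
    the next interval starts from it.\<close>
  have agree: "x t = xp i t" if "i \<le> I" "\<tau> i \<le> t" "t \<le> \<tau> (Suc i)" "t \<le> T" for i t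
  proof (rule dynamics_unique)
    show "dynamics A B w (\<tau> i) T x u"
      using dyn by (auto simp: dynamics_def \<tau>_def)
    show "dynamics A B w (\<tau> i) (\<tau> i + N - 1) (xp i) (up i)" "x (\<tau> i) = xp i (\<tau> i)"
      using plan[OF that(1)] by (auto simp: optimal_plan_def)
  qed (use that u N \<tau>_Suc in auto)
  define V where "V i = preview_cost A B c N (\<tau> i) (x (\<tau> i)) w" for i
  define S where "S i = (\<Sum>t=\<tau> i..<\<tau> (Suc i). c t (x t) (u t))" for i
  define R where "R i = (\<Sum>t=\<tau> (Suc i)..<\<tau> i + N. c t (xp i t) (up i t))" for i
  have \<tau>_pos: "1 \<le> \<tau> i" for i
    by (simp add: \<tau>_def)
  have R_nonneg: "0 \<le> R i" for i
    unfolding R_def using \<tau>_pos[of "Suc i"] by (intro sum_nonneg c_nonneg) auto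
  \<comment> \<open>Past \<open>T\<close> the trajectories may differ, but both costs are
    zero.\<close>
  have stage: "c t (x t) (u t) = c t (xp i t) (up i t)"
    if "i \<le> I" "t \<in> {\<tau> i..<\<tau> (Suc i)}" for i t
    using that agree[of i t] u[of i t] c_zero[of t] by (cases "t \<le> T") auto
  have V_split: "V i = S i + R i" if "i \<le> I" for i
  proof -
    have "V i = (\<Sum>t=\<tau> i..<\<tau> i + N. c t (xp i t) (up i t))"
      using plan[OF that] atLeastAtMost_window[of N "\<tau> i"] N
      by (simp add: optimal_plan_def V_def cost_on_def)
    also have "\<dots> = (\<Sum>t=\<tau> i..<\<tau> (Suc i). c t (xp i t) (up i t)) + R i"
      unfolding R_def using N \<tau>_Suc by (intro sum.atLeastLessThan_concat[symmetric]) auto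
    also have "(\<Sum>t=\<tau> i..<\<tau> (Suc i). c t (xp i t) (up i t)) = S i"
      unfolding S_def using stage[OF that] by (intro sum.cong) auto
    finally show ?thesis .
  qed
  have V_le: "V i \<le> \<alpha>_up * \<sigma> (x (\<tau> i)) + \<gamma>\<^sup>2 * (\<Sum>k<N. e (\<tau> i + k))" if "i \<le> I" for i
    unfolding V_def using \<tau>_pos \<tau>_le[OF that] by (rule V_upper)
  have \<sigma>_le: "\<alpha>_up * \<sigma> (x (\<tau> (Suc i))) \<le> \<theta> * R i" if "i < I" for i
  proof -
    have "\<alpha>_up * \<sigma> (x (\<tau> (Suc i))) \<le> \<theta> * c (\<tau> (Suc i)) (xp i (\<tau> (Suc i))) (up i (\<tau> (Suc i)))"
      using that agree[of i "\<tau> (Suc i)"] \<tau>_le[of "Suc i"] \<tau>_pos[of "Suc i"] \<tau>_Suc[of i]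
      by (auto intro!: c_lower)
    also have "\<dots> \<le> \<theta> * R i"
      unfolding R_def using N \<theta> \<tau>_Suc \<tau>_pos[of "Suc i"]
      by (intro mult_left_mono member_le_sum) (auto intro!: c_nonneg)
    finally show ?thesis .
  qed
  have R_le: "real M * R i \<le> \<theta> * S i + \<gamma>\<^sup>2 * (\<Sum>j=\<tau> i..<\<tau> (Suc i). \<Sum>k<N. e (j + k))"
    if "i < I" for i
  proof -
    have "R i \<le> \<theta> * c j (x j) (u j) + \<gamma>\<^sup>2 * (\<Sum>k<N. e (j + k))" if j: "j \<in> {\<tau> i..<\<tau> (Suc i)}" for j
    proof -
      have jT: "1 \<le> j" "j \<le> T"
        using j \<tau>_le[of "Suc i"] \<tau>_pos[of i] \<open>i < I\<close> by auto
      \<comment> \<open>Since \<open>j\<close> precedes the discarded half, \<open>R i\<close> is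
        part of the tail from \<open>j\<close>.\<close>
      have "R i \<le> (\<Sum>t=j..<\<tau> i + N. c t (xp i t) (up i t))"
        unfolding R_def using j jT by (intro sum_mono2) (auto intro!: c_nonneg)
      also have "\<dots> \<le> preview_cost A B c N j (xp i j) w"
        using j \<tau>_pos[of i] N \<tau>_Suc[of i] \<open>i < I\<close>
        by (intro optimal_plan_tail_le[OF _ plan]) (auto intro!: c_nonneg)
      also have "xp i j = x j"
        using agree[of i j] j jT \<open>i < I\<close> by auto
      also have "preview_cost A B c N j (x j) w \<le> \<alpha>_up * \<sigma> (x j) + \<gamma>\<^sup>2 * (\<Sum>k<N. e (j + k))"
        using jT by (rule V_upper)
      also have "\<alpha>_up * \<sigma> (x j) \<le> \<theta> * c j (x j) (u j)"
        using jT by (rule c_lower)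
      finally show ?thesis
        by simp
    qed
    then have "(\<Sum>j=\<tau> i..<\<tau> (Suc i). R i)
        \<le> (\<Sum>j=\<tau> i..<\<tau> (Suc i). \<theta> * c j (x j) (u j) + \<gamma>\<^sup>2 * (\<Sum>k<N. e (j + k)))"
      by (intro sum_mono)
    then show ?thesis
      unfolding sum.distrib sum_distrib_left[symmetric] by (simp add: S_def \<tau>_Suc)
  qed
  have J: "J = (\<Sum>i\<le>I. S i)"
  proof -
    have "(\<Sum>i\<le>I. S i) = (\<Sum>t=1..<\<tau> (Suc I). c t (x t) (u t))"
      unfolding S_def \<tau>_def lessThan_Suc_atMost[symmetric] by (rule sum_intervals)
    also have "\<dots> = J"
      unfolding J_def cost_on_def using T_less c_zero by (intro sum.mono_neutral_right) auto
    finally show ?thesis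
      by simp
  qed
  have S_nonneg: "0 \<le> S i" for i
    unfolding S_def using \<tau>_pos[of i] by (intro sum_nonneg c_nonneg) auto
  then show J_nonneg: "0 \<le> J"
    by (simp add: J sum_nonneg)
  \<comment> \<open>Interval \<open>I\<close> has no successor within the horizon, so its discarded
    cost feeds no later bound and is left out.\<close>
  define r where "r = (\<Sum>i<I. R i)"
  have r_nonneg: "0 \<le> r"
    by (simp add: r_def sum_nonneg R_nonneg)
  have M_r: "real M * r \<le> \<theta> * J + 2 * real M * G"
  proof -
    have "real M * r \<le> (\<Sum>i<I. \<theta> * S i + \<gamma>\<^sup>2 * (\<Sum>j=\<tau> i..<\<tau> (Suc i). \<Sum>k<N. e (j + k)))"
      unfolding r_def sum_distrib_left[of "real M"] by (intro sum_mono R_le) auto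
    also have "\<dots> = \<theta> * (\<Sum>i<I. S i) + \<gamma>\<^sup>2 * (\<Sum>j=1..<\<tau> I. \<Sum>k<N. e (j + k))"
      unfolding sum.distrib sum_distrib_left[symmetric] \<tau>_def sum_intervals ..
    also have "\<dots> \<le> \<theta> * J + \<gamma>\<^sup>2 * (real N * (\<Sum>t=1..T. e t))"
      using \<theta> S_nonneg e unfolding J
      by (intro add_mono mult_left_mono sum_window_energy_le sum_mono2) auto
    finally show ?thesis
      by (simp add: G_def e_def N mult_ac)
  qed
  have sum_V: "(\<Sum>i\<le>I. V i) \<le> \<theta> * r + 2 * G"
  proof -
    have "(\<Sum>i\<le>I. V i) \<le> (\<Sum>i\<le>I. \<alpha>_up * \<sigma> (x (\<tau> i)) + \<gamma>\<^sup>2 * (\<Sum>k<N. e (\<tau> i + k)))"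
      by (intro sum_mono V_le) auto
    also have "\<dots> = (\<Sum>i\<le>I. \<alpha>_up * \<sigma> (x (\<tau> i))) + \<gamma>\<^sup>2 * (\<Sum>i\<le>I. \<Sum>k<N. e (\<tau> i + k))"
      by (simp add: sum.distrib sum_distrib_left)
    \<comment> \<open>The term at time 1 vanishes; every other start has a predecessor below
      \<open>I\<close>.\<close>
    also have "(\<Sum>i\<le>I. \<alpha>_up * \<sigma> (x (\<tau> i))) = (\<Sum>i<I. \<alpha>_up * \<sigma> (x (\<tau> (Suc i))))"
      using start by (simp add: sum.atMost_shift \<tau>_def)
    also have "\<dots> \<le> \<theta> * r"
      unfolding r_def sum_distrib_left by (intro sum_mono \<sigma>_le) auto
    also have "\<gamma>\<^sup>2 * (\<Sum>i\<le>I. \<Sum>k<N. e (\<tau> i + k)) \<le> \<gamma>\<^sup>2 * (2 * (\<Sum>t=1..T. e t))"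
      unfolding \<tau>_def N lessThan_Suc_atMost[symmetric]
      by (intro mult_left_mono sum_interval_window_energy_le e) auto
    finally show ?thesis
      by (simp add: G_def e_def mult_ac)
  qed
  have "J + r \<le> (\<Sum>i\<le>I. V i)"
  proof -
    have "r \<le> (\<Sum>i\<le>I. R i)"
      unfolding r_def by (intro sum_mono2) (auto intro: R_nonneg)
    then show ?thesis
      by (simp add: J V_split sum.distrib)
  qed
  then have "J \<le> (\<theta> - 1) * r + 2 * G"
    using sum_V by (simp add: algebra_simps)
  also have "(\<theta> - 1) * r \<le> (\<zeta> - 1) * r"
    using \<theta> r_nonneg by (intro mult_right_mono) auto
  \<comment> \<open>This inequality only serves to bound \<open>r\<close>; the chain resumes with
    the bound on \<open>(\<zeta> - 1) * r\<close>.\<close>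
  also have "\<theta> * J \<le> \<zeta> * J"
    using \<theta> J_nonneg by (intro mult_right_mono)
  then have "r \<le> \<zeta> / real M * J + 2 * G"
    using M_r N by (simp add: field_simps)
  then have "(\<zeta> - 1) * r \<le> (\<zeta> - 1) * (\<zeta> / real M * J + 2 * G)"
    using \<theta> by (intro mult_left_mono) auto
  finally show "J \<le> 2 * \<zeta> * G + 2 * \<zeta> * (\<zeta> - 1) / real N * J"
    using N by (simp add: field_simps)
qed

text \<open>Choosing \<open>\<rho>\<close> before the system, the costs, the horizon and the
  trajectory makes the \<open>O(1/N)\<close> bound uniform in all of them.\<close>

theorem theorem1:
  fixes \<zeta> :: real
  assumes "\<zeta> > 1"
  shows "\<exists>\<rho> :: nat \<Rightarrow> real. \<rho> \<in> O(\<lambda>N. 1 / real N) \<and>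
    (\<forall>(A :: real^'n^'n) (B :: real^'m^'n) c w W w_c \<sigma> \<alpha>_lo \<alpha>_up \<gamma> \<beta> (N :: nat) M T x u.
       disturbance_assumption W w_c T w \<longrightarrow>
       system_assumption A B c w N T \<sigma> \<alpha>_lo \<alpha>_up \<gamma> \<longrightarrow>
       zero_past_horizon T c w \<longrightarrow>
       \<beta> = \<alpha>_lo / \<alpha>_up \<longrightarrow> \<beta> \<le> 1 \<longrightarrow>
       N = 2 * M \<longrightarrow>
       policy_op A B c w N M T x u \<longrightarrow>
       \<sigma> (x 1) = 0 \<longrightarrow>
       real N > 4 * \<zeta> ^ 3 \<longrightarrow>
       \<beta> \<ge> 1 / \<zeta> \<longrightarrow>
       T > N \<longrightarrow>
       cost_on c 1 T x u \<le> (2 * \<zeta> + \<rho> N) * \<gamma>\<^sup>2 * (\<Sum>t=1..T. (norm (w t))\<^sup>2))"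
\<comment> \<open>The witness is \<open>4 * \<zeta> * a\<close>, the excess of
  \<open>2 * \<zeta> * (1 + 2 * a)\<close> over \<open>2 * \<zeta>\<close>, for the coefficient
  \<open>a\<close> defined below.\<close>
proof (intro exI[of _ "\<lambda>N. 8 * \<zeta>\<^sup>2 * (\<zeta> - 1) / real N"] conjI allI impI)
  have "(\<lambda>N. 8 * \<zeta>\<^sup>2 * (\<zeta> - 1) * (1 / real N)) \<in> O(\<lambda>N. 1 / real N)"
    by (rule bigoI[of _ "\<bar>8 * \<zeta>\<^sup>2 * (\<zeta> - 1)\<bar>"]) (simp add: abs_mult)
  then show "(\<lambda>N. 8 * \<zeta>\<^sup>2 * (\<zeta> - 1) / real N) \<in> O(\<lambda>N. 1 / real N)"
    by simp
next
  fix A :: "real^'n^'n" and B :: "real^'m^'n" and c w W w_c \<sigma> \<alpha>_lo \<alpha>_up \<gamma> \<beta>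
    and N M T :: nat and x u
  assume sys: "system_assumption A B c w N T \<sigma> \<alpha>_lo \<alpha>_up \<gamma>"
    and past: "zero_past_horizon T c w"
    and \<beta>: "\<beta> = \<alpha>_lo / \<alpha>_up" "\<beta> \<le> 1" "\<beta> \<ge> 1 / \<zeta>"
    and N: "N = 2 * M" "real N > 4 * \<zeta> ^ 3"
    and pol: "policy_op A B c w N M T x u"
    and start: "\<sigma> (x 1) = 0" and T: "T > N"
  define J where "J = cost_on c 1 T x u"
  define G where "G = \<gamma>\<^sup>2 * (\<Sum>t=1..T. (norm (w t))\<^sup>2)"
  define a where "a = 2 * \<zeta> * (\<zeta> - 1) / real N"
  have "0 < \<zeta> ^ 3"
    using assms by simp
  then have "0 < real N"
    using N by linarith
  then have M: "0 < M"
    using N by simp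
  have "\<alpha>_lo \<le> \<alpha>_up" "\<alpha>_up \<le> \<zeta> * \<alpha>_lo"
    using \<beta> sys assms by (auto simp: system_assumption_def field_simps)
  note gain = policy_op_gain[OF sys past this N(1) M pol start]
  have J: "J \<le> 2 * \<zeta> * G + a * J" "0 \<le> J"
    using gain T unfolding J_def G_def a_def by auto
  have G: "0 \<le> G"
    unfolding G_def by (intro mult_nonneg_nonneg sum_nonneg) auto
  \<comment> \<open>Together with \<open>N > 4 * \<zeta> ^ 3\<close> this yields
    \<open>a \<le> 1 / 2\<close>.\<close>
  have "\<zeta> * (\<zeta> - 1) \<le> \<zeta> ^ 3"
  proof -
    have "\<zeta> * (\<zeta> - 1) \<le> \<zeta> ^ 2"
      using assms by (simp add: power2_eq_square algebra_simps)
    also have "\<dots> \<le> \<zeta> ^ 3"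
      using assms by (intro power_increasing) auto
    finally show ?thesis .
  qed
  then have a: "0 \<le> a" "a \<le> 1 / 2"
    using N assms \<open>0 < real N\<close> by (auto simp: a_def field_simps)
  \<comment> \<open>On \<open>0 \<le> a \<le> 1 / 2\<close> the factor \<open>1 / (1 - a)\<close> is
    at most \<open>1 + 2 * a\<close>, which keeps the remainder linear in \<open>a\<close>.\<close>
  have "J * 1 \<le> J * ((1 - a) * (1 + 2 * a))"
  proof (intro mult_left_mono J)
    have "0 \<le> a * (1 - 2 * a)"
      using a by simp
    then show "1 \<le> (1 - a) * (1 + 2 * a)"
      by (simp add: algebra_simps)
  qed
  also have "\<dots> = (J - a * J) * (1 + 2 * a)"
    by (simp add: algebra_simps)
  also have "\<dots> \<le> 2 * \<zeta> * G * (1 + 2 * a)"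
    using J a by (intro mult_right_mono) auto
  also have "\<dots> = (2 * \<zeta> + 8 * \<zeta>\<^sup>2 * (\<zeta> - 1) / real N) * G"
    by (simp add: a_def algebra_simps power2_eq_square)
  finally show "cost_on c 1 T x u \<le> (2 * \<zeta> + 8 * \<zeta>\<^sup>2 * (\<zeta> - 1) / real N) * \<gamma>\<^sup>2
      * (\<Sum>t=1..T. (norm (w t))\<^sup>2)"
    by (simp add: J_def G_def mult.assoc)
qed

end
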